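(* Let $M$ be a monoid that satisfies Property (C$_4$). Suppose that for each $n>0$, $M$ satisfies the identity $$(x_1 x_2 \cdots x_n)(x_n x_{n-1} \cdots x_1)(x_1 x_2 \cdots x_n) \approx (x_1 x_2 \cdots x_n)(x_1^2 x_2^2 \cdots x_n^2),$$ where $x_1,\dots,x_n$ are distinct variables. Then $M$ is non-finitely based.
   Context: Let $\mathfrak A$ be a countably infinite alphabet of variables; elements of the free semigroup $\mathfrak A^+$ and the free monoid $\mathfrak A^*$ are called words. An identity is a formal equality $\mathbf u\approx\mathbf v$ of words; a semigroup (or monoid) $S$ satisfies it if $\mathbf u$ and $\mathbf v$ take equal values under every assignment of elements of $S$ to the variables. $S$ is finitely based if there is a finite subset of its identities from which all its identities can be deduced; otherwise $S$ is non-finitely based. Two words have the same type if one can be obtained from the other by changing the individual exponents of variables, i.e. they can be written as $c_1^{u_1}\cdots c_r^{u_r}$ and $c_1^{v_1}\cdots c_r^{v_r}$ with variables $c_i\neq c_{i+1}$ and all $u_i,v_i\ge 1$. An island formed by a variable $x$ in a word $\mathbf u$ is a maximal (contiguous) subword of $\mathbf u$ that is a power of $x$. The height of a word over a two-letter alphabet is its number of islands. For $\ell\ge 2$, a semigroup $S$ satisfies Property (C$_\ell$) if for every word $\mathbf u\in\{x,y\}^+$ ($x,y$ distinct variables) of height at most $\ell$, whenever $S$ satisfies an identity $\mathbf u\approx\mathbf v$, the word $\mathbf v$ has the same type as $\mathbf u$. *)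

theory Defs
  imports "HOL-Algebra.Group"
begin

text \<open>Words are lists over the countably infinite alphabet of variables \<^typ>\<open>nat\<close>;
  the free monoid is the type of all lists, the free semigroup consists of the nonempty ones.\<close>

type_synonym var = nat
type_synonym word = "var list"

definition word_value :: "('a, 'b) monoid_scheme \<Rightarrow> (var \<Rightarrow> 'a) \<Rightarrow> word \<Rightarrow> 'a" where
  "word_value M \<phi> w = foldr (\<lambda>x a. \<phi> x \<otimes>\<^bsub>M\<^esub> a) w \<one>\<^bsub>M\<^esub>"

definition satisfies :: "('a, 'b) monoid_scheme \<Rightarrow> word \<Rightarrow> word \<Rightarrow> bool" where
  "satisfies M u v \<longleftrightarrow> (\<forall>\<phi> \<in> UNIV \<rightarrow> carrier M. word_value M \<phi> u = word_value M \<phi> v)"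

definition identities :: "('a, 'b) monoid_scheme \<Rightarrow> (word \<times> word) set" where
  "identities M = {(u, v). satisfies M u v}"

text \<open>Equational deduction for monoid identities. Substitutions may send variables to the
  empty word, as variables of monoid identities may be assigned the unit.\<close>

inductive deducible :: "(word \<times> word) set \<Rightarrow> word \<Rightarrow> word \<Rightarrow> bool" for E where
  hyp: "(u, v) \<in> E \<Longrightarrow> deducible E u v"
| refl: "deducible E u u"
| sym: "deducible E u v \<Longrightarrow> deducible E v u"
| trans: "deducible E u v \<Longrightarrow> deducible E v w \<Longrightarrow> deducible E u w"
| mult: "deducible E u v \<Longrightarrow> deducible E u' v' \<Longrightarrow> deducible E (u @ u') (v @ v')"
| subst: "deducible E u v \<Longrightarrow> deducible E (concat (map \<theta> u)) (concat (map \<theta> v))"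

definition finitely_based :: "('a, 'b) monoid_scheme \<Rightarrow> bool" where
  "finitely_based M \<longleftrightarrow>
     (\<exists>E. finite E \<and> E \<subseteq> identities M \<and> (\<forall>(u, v) \<in> identities M. deducible E u v))"

text \<open>\<open>word_of_powers [c\<^sub>1, \<dots>, c\<^sub>r] [k\<^sub>1, \<dots>, k\<^sub>r]\<close> is the word
  \<open>c\<^sub>1\<^bsup>k\<^sub>1\<^esup> \<cdots> c\<^sub>r\<^bsup>k\<^sub>r\<^esup>\<close>.\<close>

definition word_of_powers :: "var list \<Rightarrow> nat list \<Rightarrow> word" where
  "word_of_powers cs ks = concat (map2 (\<lambda>c k. replicate k c) cs ks)"

definition same_type :: "word \<Rightarrow> word \<Rightarrow> bool" where
  "same_type u v \<longleftrightarrow>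
     (\<exists>cs ks ls. distinct_adj cs \<and> length ks = length cs \<and> length ls = length cs \<and>
        (\<forall>k \<in> set ks. k \<ge> 1) \<and> (\<forall>l \<in> set ls. l \<ge> 1) \<and>
        u = word_of_powers cs ks \<and> v = word_of_powers cs ls)"

text \<open>Islands are counted as occurrences, so an island is represented by its position: the part
  \<open>p\<close> of the word before it, its length \<open>k\<close> and the part \<open>s\<close> after it.\<close>

definition islands :: "var \<Rightarrow> word \<Rightarrow> (word \<times> nat \<times> word) set" where
  "islands x w = {(p, k, s). w = p @ replicate k x @ s \<and> k \<ge> 1 \<and>
     (p = [] \<or> last p \<noteq> x) \<and> (s = [] \<or> hd s \<noteq> x)}"

definition height :: "word \<Rightarrow> nat" where
  "height w = (\<Sum>x \<in> set w. card (islands x w))"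

text \<open>Property (C) is a property of semigroups, so both words are nonempty.\<close>

definition property_C :: "nat \<Rightarrow> ('a, 'b) monoid_scheme \<Rightarrow> bool" where
  "property_C l M \<longleftrightarrow>
     (\<forall>x y u v. x \<noteq> y \<longrightarrow> u \<noteq> [] \<longrightarrow> set u \<subseteq> {x, y} \<longrightarrow> height u \<le> l \<longrightarrow>
        v \<noteq> [] \<longrightarrow> satisfies M u v \<longrightarrow> same_type u v)"

end

theory Submission
  imports Defs "HOL-Library.Sublist"
begin

text \<open>
  By Property (C\<open>\<^sub>4\<close>), collapsing \<open>x\<^sub>1, \<dots>, x\<^sub>k\<close> to \<open>x\<close> and the other variables to \<open>y\<close>
  preserves the type \<open>xyxy\<close>, so every word equal in \<open>M\<close> to the left-hand side of the \<open>n\<close>-th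
  identity goes up from \<open>x\<^sub>1\<close> to \<open>x\<^sub>n\<close>, down through some set \<open>D\<close> of variables, and up again.
  On the left-hand side \<open>D\<close> is everything, on the right-hand side it has no inner variable.

  Apply an identity \<open>u \<approx> v\<close> in few variables through a substitution \<open>\<theta>\<close>. A variable occurring three
  or more times in \<open>u\<close> can only be sent to a power of a single letter, so most letters arise
  from variables occurring at most twice, and Property (C\<open>\<^sub>4\<close>) controls how those are placed in
  \<open>v\<close>. It follows that a letter \<open>d \<in> D\<close> away from both ends stays in \<open>D\<close> as long as \<open>D\<close> contains
  many letters on one side of \<open>d\<close>. Hence a deduction from identities in boundedly many variables
  never empties the middle of \<open>D\<close> once \<open>n\<close> is large.
\<close>

subsection \<open>Subsequences, islands and types\<close>

abbreviation (input) subst_word :: "('v \<Rightarrow> 'c list) \<Rightarrow> 'v list \<Rightarrow> 'c list" where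
  "subst_word \<theta> u \<equiv> concat (map \<theta> u)"

text \<open>Consecutive letters of a pattern without equal neighbours come from different islands,
  so shrinking every island to one letter loses none of them. Types can therefore be compared
  through the alternating patterns they contain.\<close>

lemma subseq_distinct_adj_remdups_adj:
  "distinct_adj xs \<Longrightarrow> subseq xs ys \<longleftrightarrow> subseq xs (remdups_adj ys)"
proof (induction ys arbitrary: xs rule: remdups_adj.induct)
  case (3 x y ys)
  show ?case
  proof (cases "x = y")
    case True
    have "subseq xs (y # y # ys) \<longleftrightarrow> subseq xs (y # ys)" if "distinct_adj xs" for xs
      using that by (cases xs; cases "tl xs") (auto simp: distinct_adj_Cons split: if_splits)
    with 3 True show ?thesis by simp
  next
    case False
    show ?thesis
    proof (cases xs)
      case (Cons z zs)
      with 3(3) have "distinct_adj zs" by (auto dest: distinct_adj_ConsD)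
      with 3(2)[OF False, of zs] 3(2)[OF False, of xs] 3(3) Cons False show ?thesis
        by (auto simp del: remdups_adj.simps(3) simp add: remdups_adj.simps(3)[of x y])
    qed simp
  qed
qed simp_all

lemma subseq_map_iff: "subseq ps (map f u) \<longleftrightarrow> (\<exists>qs. map f qs = ps \<and> subseq qs u)"
proof
  show "subseq ps (map f u) \<Longrightarrow> \<exists>qs. map f qs = ps \<and> subseq qs u"
  proof (induction u arbitrary: ps)
    case Nil
    then show ?case by (cases ps) simp_all
  next
    case (Cons a u)
    show ?case
    proof (cases "subseq ps (map f u)")
      case True
      with Cons.IH show ?thesis by blast
    next
      case False
      with Cons.prems obtain ps' where "ps = f a # ps'" "subseq ps' (map f u)"
        by (cases ps) (auto split: if_splits)
      with Cons.IH[of ps'] obtain qs where "map f (a # qs) = ps" "subseq (a # qs) (a # u)"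
        by auto
      then show ?thesis by blast
    qed
  qed
qed (auto intro: subseq_map)

lemma set_mono_subseq: "subseq xs ys \<Longrightarrow> set xs \<subseteq> set ys"
  by (induction rule: list_emb.induct) auto

lemma subseq_filter_iff: "subseq qs (filter P u) \<longleftrightarrow> subseq qs u \<and> (\<forall>q \<in> set qs. P q)"
proof
  assume "subseq qs (filter P u)"
  then have "subseq qs u"
    by (rule subseq_order.trans) simp
  moreover have "set qs \<subseteq> set (filter P u)"
    using \<open>subseq qs (filter P u)\<close> by (rule set_mono_subseq)
  ultimately show "subseq qs u \<and> (\<forall>q \<in> set qs. P q)" by auto
next
  assume "subseq qs u \<and> (\<forall>q \<in> set qs. P q)"
  then show "subseq qs (filter P u)"
    by (metis filter_True subseq_filter)
qed

lemma subseq_subst_word: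
  "subseq qs u \<Longrightarrow> list_all2 (\<lambda>p q. subseq p (\<theta> q)) ps qs \<Longrightarrow> subseq (concat ps) (subst_word \<theta> u)"
proof (induction u arbitrary: ps qs)
  case Nil
  then show ?case by (cases qs) simp_all
next
  case (Cons a u)
  show ?case
  proof (cases "subseq qs u")
    case True
    with Cons show ?thesis by (auto intro: subseq_drop_many)
  next
    case False
    with Cons.prems obtain qs' where "qs = a # qs'" "subseq qs' u"
      by (cases qs) (auto split: if_splits)
    moreover from this Cons.prems(2) obtain p ps' where
      "ps = p # ps'" "subseq p (\<theta> a)" "list_all2 (\<lambda>p q. subseq p (\<theta> q)) ps' qs'"
      by (auto simp: list_all2_Cons2)
    ultimately show ?thesis
      using Cons.IH[of qs' ps'] list_emb_append_mono[of "(=)" p "\<theta> a"] by simp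
  qed
qed

lemma subseq_replicate_iff: "subseq (replicate k s) u \<longleftrightarrow> k \<le> count_list u s"
proof (induction u arbitrary: k)
  case Nil
  show ?case by (cases k) simp_all
next
  case (Cons a u)
  then show ?case using Cons.IH[of k] Cons.IH[of "k - 1"] by (cases k) auto
qed

section \<open>Heights and types through \<open>remdups_adj\<close>\<close>

lemma length_remdups_adj_eq_card:
  "length (remdups_adj w) = card {i. i < length w \<and> (i = 0 \<or> w ! (i - 1) \<noteq> w ! i)}"
proof (induction w rule: remdups_adj.induct)
  case (2 x)
  have "{i. i < length [x] \<and> (i = 0 \<or> [x] ! (i - 1) \<noteq> [x] ! i)} = {0}" by auto
  then show ?case by simp
next
  case (3 x y ys)
  let ?S = "\<lambda>w. {i. i < length w \<and> (i = 0 \<or> w ! (i - 1) \<noteq> w ! i)}"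
  let ?R = "{i. i < length (y # ys) \<and> i > 0 \<and> (y # ys) ! (i - 1) \<noteq> (y # ys) ! i}"
  have S1: "?S (y # ys) = insert 0 ?R" by auto
  \<comment> \<open>Prepending \<open>x\<close> shifts all island starts by one; the old start 0
    becomes 1 and survives exactly when \<open>x\<close> and \<open>y\<close> differ.\<close>
  have S2: "?S (x # y # ys) = insert 0 ((if x = y then {} else {1}) \<union> Suc ` ?R)"
  proof (rule Set.set_eqI)
    fix i show "i \<in> ?S (x # y # ys) \<longleftrightarrow> i \<in> insert 0 ((if x = y then {} else {1}) \<union> Suc ` ?R)"
    proof (cases i)
      case (Suc k)
      then show ?thesis by (cases k) (auto simp: image_iff)
    qed auto
  qed
  have c: "card (?S (y # ys)) = Suc (card ?R)" unfolding S1 by (subst card_insert_disjoint) auto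
  have "card (?S (x # y # ys)) = card (?S (y # ys)) + (if x = y then 0 else 1)"
  proof -
    have R: "finite ?R" "card (Suc ` ?R) = card ?R" "1 \<notin> Suc ` ?R" "0 \<notin> Suc ` ?R"
      by (auto simp: card_image)
    then show ?thesis unfolding S2 c by (cases "x = y") (simp_all del: image_Collect image_eqI)
  qed
  with 3(1,2) show ?case
    by (cases "x = y") (simp_all only: remdups_adj.simps if_True if_False list.size simp_thms add_0_right)
qed simp

text \<open>The starting position of an island determines its letter, its length and the rest of the
  word, so islands inject into the starting positions. The bound makes words with a short
  \<open>remdups_adj\<close> accessible to \<open>property_C\<close>.\<close>

lemma height_le_length_remdups_adj: "height w \<le> length (remdups_adj w)"
proof -
  let ?S = "{i. i < length w \<and> (i = 0 \<or> w ! (i - 1) \<noteq> w ! i)}"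
  let ?I = "SIGMA x:set w. islands x w"
  let ?pos = "\<lambda>(x :: var, p :: word, k :: nat, s :: word). length p"
  have hd: "w ! length p = x" "length p < length w" "p = take (length p) w"
    "k = length (takeWhile (\<lambda>z. z = x) (drop (length p) w))"
    "s = dropWhile (\<lambda>z. z = x) (drop (length p) w)"
    "length p = 0 \<or> w ! (length p - 1) \<noteq> w ! length p"
    if "(p, k, s) \<in> islands x w" for x p k s
  proof -
    from that have w: "w = p @ replicate k x @ s" "k \<ge> 1" "p = [] \<or> last p \<noteq> x" "s = [] \<or> hd s \<noteq> x"
      by (auto simp: islands_def)
    from w(4) have tw: "takeWhile (\<lambda>z. z = x) s = []" "dropWhile (\<lambda>z. z = x) s = s"
      by (cases s; auto)+
    from w(2) obtain k' where k': "k = Suc k'" by (cases k) auto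
    show "w ! length p = x" "length p < length w" "p = take (length p) w"
      using w(1) k' by (auto simp: nth_append)
    show "k = length (takeWhile (\<lambda>z. z = x) (drop (length p) w))"
      "s = dropWhile (\<lambda>z. z = x) (drop (length p) w)"
      using w(1) tw by (auto simp: takeWhile_append dropWhile_append)
    show "length p = 0 \<or> w ! (length p - 1) \<noteq> w ! length p"
      using w k' by (cases p rule: rev_cases) (auto simp: nth_append)
  qed
  have inj: "inj_on ?pos ?I"
  proof (rule inj_onI)
    fix a b assume "a \<in> ?I" "b \<in> ?I" "?pos a = ?pos b"
    moreover obtain x p k s where a: "a = (x, p, k, s)" by (cases a)
    moreover obtain x' p' k' s' where b: "b = (x', p', k', s')" by (cases b)
    ultimately have 1: "(p, k, s) \<in> islands x w" "(p', k', s') \<in> islands x' w" "length p = length p'"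
      by auto
    have "x = x'" "p = p'" using hd(1,3)[OF 1(1)] hd(1,3)[OF 1(2)] 1(3) by auto
    moreover have "k = k'" "s = s'"
      using hd(4,5)[OF 1(1)] hd(4,5)[OF 1(2)] 1(3) \<open>x = x'\<close> by auto
    ultimately show "a = b" using a b by simp
  qed
  have sub: "?pos ` ?I \<subseteq> ?S" using hd(2,6) by fastforce
  have "finite ?I" using inj_on_finite[OF inj sub] by simp
  \<comment> \<open>The sum of cardinalities becomes the cardinality of \<open>?I\<close> only for
    finite summands, since \<open>card\<close> is 0 on infinite sets.\<close>
  then have fin: "finite (islands x w)" if "x \<in> set w" for x
  proof -
    from that have "Pair x ` islands x w \<subseteq> ?I" by auto
    with \<open>finite ?I\<close> have "finite (Pair x ` islands x w)" by (rule finite_subset[rotated])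
    then show ?thesis by (rule finite_imageD) (simp add: inj_on_def)
  qed
  have "height w = card ?I"
    unfolding height_def using fin by (subst card_SigmaI) auto
  also have "\<dots> \<le> card ?S" by (rule card_inj_on_le[OF inj sub]) simp
  finally show ?thesis by (simp add: length_remdups_adj_eq_card)
qed

lemma remdups_adj_word_of_powers:
  "distinct_adj cs \<Longrightarrow> length ks = length cs \<Longrightarrow> \<forall>k \<in> set ks. k \<ge> 1 \<Longrightarrow>
   remdups_adj (word_of_powers cs ks) = cs"
proof (induction cs arbitrary: ks)
  case (Cons c cs)
  then obtain k ks' where ks: "ks = Suc k # ks'" by (cases ks; cases "hd ks") auto
  have IH: "remdups_adj (word_of_powers cs ks') = cs"
    using Cons ks by (auto dest: distinct_adj_ConsD)
  then have hd: "word_of_powers cs ks' = [] \<longleftrightarrow> cs = []" "hd (word_of_powers cs ks') = hd cs"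
    by (metis remdups_adj_Nil_iff, metis hd_remdups_adj)
  have "remdups_adj (replicate (Suc k) c @ word_of_powers cs ks') = c # cs"
  proof (induction k)
    case 0
    show ?case using IH hd Cons.prems(1)
      by (cases "word_of_powers cs ks'") (auto simp: distinct_adj_Cons remdups_adj_Cons')
  next
    case (Suc k)
    then show ?case by simp
  qed
  then show ?case by (simp add: ks word_of_powers_def)
qed (simp add: word_of_powers_def)

text \<open>\<open>remdups_adj\<close> recovers the sequence of island letters, so having the same
  type becomes an equation.\<close>

lemma same_type_remdups_adj: "same_type u v \<Longrightarrow> remdups_adj u = remdups_adj v"
  unfolding same_type_def using remdups_adj_word_of_powers by metis

subsection \<open>Two-letter consequences of Property (C)\<close>

text \<open>A word over \<^typ>\<open>bool\<close> has height at most 4 iff it has no alternating subsequence of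
  length 5. So \<^term>\<open>tight u v\<close> is what Property (C\<open>\<^sub>4\<close>) says about the identity
  \<open>u \<approx> v\<close> and all its substitution instances in two letters.\<close>

definition low_alt :: "bool list \<Rightarrow> bool" where
  "low_alt w \<longleftrightarrow> \<not> subseq [True, False, True, False, True] w \<and> \<not> subseq [False, True, False, True, False] w"

definition tight :: "word \<Rightarrow> word \<Rightarrow> bool" where
  "tight u v \<longleftrightarrow> (\<forall>\<psi>. low_alt (subst_word \<psi> u) \<or> low_alt (subst_word \<psi> v) \<longrightarrow>
     remdups_adj (subst_word \<psi> u) = remdups_adj (subst_word \<psi> v))"

lemma tight_sym: "tight u v \<Longrightarrow> tight v u"
  unfolding tight_def by metis

lemma subseq_rev_rev: "subseq (rev xs) (rev ys) \<longleftrightarrow> subseq xs ys"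
proof -
  have "subseq (rev xs) (rev ys)" if "subseq xs ys" for xs ys :: "'a list"
    using that by (induction rule: list_emb.induct) (auto intro: subseq_rev_drop_many)
  from this[of xs ys] this[of "rev xs" "rev ys"] show ?thesis by auto
qed

lemma subseq_rev_iff: "subseq xs (rev ys) \<longleftrightarrow> subseq (rev xs) ys"
  using subseq_rev_rev[of "rev xs" ys] by simp

lemma low_alt_rev: "low_alt (rev w) \<longleftrightarrow> low_alt w"
  by (simp add: low_alt_def subseq_rev_iff)

lemma tight_rev:
  assumes "tight u v"
  shows "tight (rev u) (rev v)"
proof -
  have eq: "subst_word \<psi> (rev z) = rev (subst_word (rev \<circ> \<psi>) z)" for \<psi> :: "var \<Rightarrow> bool list" and z
    by (induction z) auto
  show ?thesis
    using assms unfolding tight_def eq low_alt_rev remdups_adj_rev by auto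
qed

lemma length_remdups_adj_low_alt:
  assumes "low_alt w"
  shows "length (remdups_adj w) \<le> 4"
proof (rule ccontr)
  assume "\<not> ?thesis"
  then have "length (take 5 (remdups_adj w)) = 5" by simp
  moreover have "\<exists>a b c d e. xs = [a, b, c, d, e]" if "length xs = 5" for xs :: "bool list"
    using that by (auto simp: length_Suc_conv numeral_eq_Suc)
  ultimately obtain a b c d e where "take 5 (remdups_adj w) = [a, b, c, d, e]" by blast
  then obtain r where eq: "remdups_adj w = [a, b, c, d, e] @ r"
    using append_take_drop_id[of 5 "remdups_adj w"] by metis
  have adj: "distinct_adj (remdups_adj w)" by simp
  then have "a \<noteq> b" "b \<noteq> c" "c \<noteq> d" "d \<noteq> e" unfolding eq by (simp_all add: distinct_adj_Cons)
  then have "[a, b, c, d, e] = [True, False, True, False, True] \<or>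
    [a, b, c, d, e] = [False, True, False, True, False]"
    by (cases a) auto
  moreover have "subseq [a, b, c, d, e] w"
    using subseq_distinct_adj_remdups_adj[of "[a, b, c, d, e]" w] \<open>a \<noteq> b\<close> \<open>b \<noteq> c\<close> \<open>c \<noteq> d\<close> \<open>d \<noteq> e\<close>
    by (simp add: eq distinct_adj_Cons)
  ultimately show False using assms by (auto simp: low_alt_def)
qed

text \<open>Erase the variables outside \<open>K\<close> and rename the others by \<open>f\<close>.
  The last hypothesis makes the image of \<open>v\<close> low, so both images have the same type and
  contain the same alternating patterns.\<close>

lemma tight_pattern:
  assumes "tight u v" and "distinct_adj ps"
    and "\<And>qs. subseq qs v \<Longrightarrow> set qs \<subseteq> K \<Longrightarrow>
      map f qs \<noteq> [True, False, True, False, True] \<and> map f qs \<noteq> [False, True, False, True, False]"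
  shows "(\<exists>qs. subseq qs u \<and> set qs \<subseteq> K \<and> map f qs = ps) \<longleftrightarrow>
    (\<exists>qs. subseq qs v \<and> set qs \<subseteq> K \<and> map f qs = ps)"
proof -
  let ?\<psi> = "\<lambda>t. if t \<in> K then [f t] else []"
  have eq: "subst_word ?\<psi> z = map f (filter (\<lambda>t. t \<in> K) z)" for z
    by (induction z) auto
  have iff: "subseq as (subst_word ?\<psi> z) \<longleftrightarrow> (\<exists>qs. subseq qs z \<and> set qs \<subseteq> K \<and> map f qs = as)" for as z
    unfolding eq subseq_map_iff subseq_filter_iff by auto
  have "low_alt (subst_word ?\<psi> v)"
    unfolding low_alt_def iff by (auto dest: assms(3))
  then have "remdups_adj (subst_word ?\<psi> u) = remdups_adj (subst_word ?\<psi> v)"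
    using assms(1) unfolding tight_def by blast
  then have "subseq ps (subst_word ?\<psi> u) \<longleftrightarrow> subseq ps (subst_word ?\<psi> v)"
    using subseq_distinct_adj_remdups_adj[OF assms(2), of "subst_word ?\<psi> u"]
      subseq_distinct_adj_remdups_adj[OF assms(2), of "subst_word ?\<psi> v"] by argo
  then show ?thesis unfolding iff .
qed

text \<open>The case \<open>K = {a, b}\<close> of \<open>tight_pattern\<close>: the renaming is
  injective on \<open>K\<close>, so each pattern lifts to only one word in \<open>a\<close> and
  \<open>b\<close>.\<close>

lemma tight_pair:
  assumes "tight u v" and "a \<noteq> b" and "distinct_adj ps" and "set ps \<subseteq> {a, b}"
    and "\<not> subseq [a, b, a, b, a] v" and "\<not> subseq [b, a, b, a, b] v"
  shows "subseq ps u \<longleftrightarrow> subseq ps v"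
proof -
  let ?f = "\<lambda>t. t = a"
  have inj: "qs = qs'" if "map ?f qs = map ?f qs'" "set qs \<subseteq> {a, b}" "set qs' \<subseteq> {a, b}" for qs qs'
    using that assms(2) by (intro map_inj_on[of ?f qs qs']) (auto simp: inj_on_def)
  have adj: "distinct_adj (map ?f ps)"
    using assms(2-4) by (intro distinct_adj_mapI) (auto simp: inj_on_def)
  have "(\<exists>qs. subseq qs u \<and> set qs \<subseteq> {a, b} \<and> map ?f qs = map ?f ps) \<longleftrightarrow>
    (\<exists>qs. subseq qs v \<and> set qs \<subseteq> {a, b} \<and> map ?f qs = map ?f ps)"
  proof (rule tight_pattern[OF assms(1) adj], intro conjI notI)
    fix qs assume qs: "subseq qs v" "set qs \<subseteq> {a, b}"
    { assume "map ?f qs = [True, False, True, False, True]"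
      with qs(2) assms(2) have "qs = [a, b, a, b, a]" by (intro inj) auto
      with qs(1) assms(5) show False by simp }
    { assume "map ?f qs = [False, True, False, True, False]"
      with qs(2) assms(2) have "qs = [b, a, b, a, b]" by (intro inj) auto
      with qs(1) assms(6) show False by simp }
  qed
  with inj assms(4) show ?thesis by metis
qed

text \<open>Sending \<open>s\<close> to two different letters and erasing the rest makes two islands
  of each occurrence. Two occurrences give height at most 4, and the length of the alternating image
  then reveals their number.\<close>

lemma tight_count_list:
  assumes "tight u v" and "count_list u s \<le> 2"
  shows "count_list v s = count_list u s"
proof -
  let ?\<psi> = "\<lambda>t. if t = s then [True, False] else []"
  have len: "length (subst_word ?\<psi> z) = 2 * count_list z s" for z
    by (induction z) auto
  have adj: "subst_word ?\<psi> z = [] \<or> hd (subst_word ?\<psi> z)" "distinct_adj (subst_word ?\<psi> z)" for z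
    by (induction z) (auto simp: distinct_adj_Cons)
  have "low_alt (subst_word ?\<psi> u)"
    using assms(2) by (auto simp: low_alt_def len)
  then have "subst_word ?\<psi> u = subst_word ?\<psi> v"
    using assms(1) adj(2) unfolding tight_def distinct_adj_altdef by metis
  then show ?thesis using len[of u] len[of v] by simp
qed

section \<open>Satisfied identities, and the passage from Property (C4) to
  \<open>tight\<close>\<close>

lemma word_value_closed:
  "monoid M \<Longrightarrow> \<phi> \<in> UNIV \<rightarrow> carrier M \<Longrightarrow> word_value M \<phi> u \<in> carrier M"
  by (induction u) (auto simp: word_value_def monoid.one_closed monoid.m_closed Pi_iff)

lemma word_value_append:
  "monoid M \<Longrightarrow> \<phi> \<in> UNIV \<rightarrow> carrier M \<Longrightarrow>
   word_value M \<phi> (u @ v) = word_value M \<phi> u \<otimes>\<^bsub>M\<^esub> word_value M \<phi> v"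
proof (induction u)
  case Nil
  then show ?case using word_value_closed[of M \<phi> v] by (simp add: word_value_def monoid.l_one)
next
  case (Cons a u)
  have "word_value M \<phi> (z # w) = \<phi> z \<otimes>\<^bsub>M\<^esub> word_value M \<phi> w" for z w
    by (simp add: word_value_def)
  with Cons show ?case
    by (simp add: monoid.m_assoc word_value_closed Pi_iff)
qed

lemma word_value_subst_word:
  "monoid M \<Longrightarrow> \<phi> \<in> UNIV \<rightarrow> carrier M \<Longrightarrow>
   word_value M \<phi> (subst_word \<theta> u) = word_value M (\<lambda>t. word_value M \<phi> (\<theta> t)) u"
proof (induction u)
  case (Cons a u)
  then show ?case by (simp add: word_value_append) (simp add: word_value_def)
qed (simp add: word_value_def)

lemma satisfies_subst_word:
  assumes "monoid M" and "satisfies M u v"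
  shows "satisfies M (subst_word \<theta> u) (subst_word \<theta> v)"
  using assms unfolding satisfies_def
  by (auto simp: word_value_subst_word word_value_closed Pi_iff)

lemma satisfies_append:
  assumes "monoid M" and "satisfies M u v" and "satisfies M u' v'"
  shows "satisfies M (u @ u') (v @ v')"
  using assms unfolding satisfies_def by (auto simp: word_value_append)

lemma satisfies_refl: "satisfies M u u"
  by (simp add: satisfies_def)

lemma satisfies_sym: "satisfies M u v \<Longrightarrow> satisfies M v u"
  by (simp add: satisfies_def)

lemma satisfies_trans: "satisfies M u v \<Longrightarrow> satisfies M v w \<Longrightarrow> satisfies M u w"
  by (simp add: satisfies_def)

lemma property_C_same_type:
  assumes "property_C 4 M" and "satisfies M u v" and "u \<noteq> []" and "v \<noteq> []"
    and "set u \<subseteq> {0, 1}" and "length (remdups_adj u) \<le> 4"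
  shows "remdups_adj u = remdups_adj v"
proof -
  have "height u \<le> 4" using height_le_length_remdups_adj[of u] assms(6) by simp
  moreover have "(0 :: var) \<noteq> 1" by simp
  ultimately have "same_type u v"
    using assms(1-5) unfolding property_C_def by blast
  then show ?thesis by (rule same_type_remdups_adj)
qed

text \<open>\<open>property_C\<close> covers nonempty words only, so the empty word is treated
  separately: identifying all variables of \<open>w\<close> with 0 and multiplying by a new letter 1
  on the left gives an identity between 1 and a word containing 0, of different types.\<close>

lemma property_C_satisfies_Nil:
  assumes "monoid M" and "property_C 4 M" and "satisfies M w []"
  shows "w = []"
proof (rule ccontr)
  assume "w \<noteq> []"
  have "subst_word (\<lambda>_. [0]) w = replicate (length w) (0 :: var)"
    by (induction w) auto
  with satisfies_subst_word[OF assms(1,3), of "\<lambda>_. [0]"]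
  have "satisfies M (replicate (length w) 0) []" by simp
  then have "satisfies M ([1] @ []) ([1] @ replicate (length w) 0)"
    by (intro satisfies_append assms(1) satisfies_refl) (rule satisfies_sym)
  then have "remdups_adj [1] = remdups_adj (1 # replicate (length w) (0 :: var))"
    by (intro property_C_same_type[OF assms(2)]) auto
  then have "set [1] = set (1 # replicate (length w) (0 :: var))"
    by (metis remdups_adj_set)
  with \<open>w \<noteq> []\<close> show False by auto
qed

lemma property_C_tight:
  assumes "monoid M" and "property_C 4 M" and "satisfies M u v"
  shows "tight u v"
proof -
  let ?e = "\<lambda>b. if b then 0 else (1 :: var)"
  have inj: "inj ?e" by (auto simp: inj_def)
  \<comment> \<open>Stated for arbitrary words, so that it also serves when the low image is that of
    the right-hand side.\<close>
  have main: "remdups_adj (subst_word \<psi> u) = remdups_adj (subst_word \<psi> v)"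
    if low: "low_alt (subst_word \<psi> u)" and sat: "satisfies M u v" for \<psi> u v
  proof -
    let ?U = "map ?e (subst_word \<psi> u)" and ?V = "map ?e (subst_word \<psi> v)"
    have "subst_word (map ?e \<circ> \<psi>) z = map ?e (subst_word \<psi> z)" for z
      by (induction z) auto
    with satisfies_subst_word[OF assms(1) sat, of "map ?e \<circ> \<psi>"] have UV: "satisfies M ?U ?V" by simp
    have "?U = [] \<longleftrightarrow> ?V = []"
      using property_C_satisfies_Nil[OF assms(1,2), of ?U] UV
        property_C_satisfies_Nil[OF assms(1,2), of ?V] satisfies_sym[OF UV] by metis
    moreover have "remdups_adj ?U = remdups_adj ?V" if "?U \<noteq> []" "?V \<noteq> []"
      using that by (intro property_C_same_type[OF assms(2) UV])
        (auto simp: remdups_adj_map_injective[OF inj] length_remdups_adj_low_alt[OF low])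
    ultimately have "remdups_adj ?U = remdups_adj ?V" by metis
    then show ?thesis
      unfolding remdups_adj_map_injective[OF inj] using inj by (simp add: inj_map_eq_map)
  qed
  show ?thesis
    unfolding tight_def using main assms(3) satisfies_sym[OF assms(3)] by metis
qed

section \<open>Subsequences as increasing positions of letters\<close>

definition letter_at :: "'c list \<Rightarrow> nat \<Rightarrow> 'c \<Rightarrow> bool" where
  "letter_at w i a \<longleftrightarrow> i < length w \<and> w ! i = a"

lemma letter_at_unique: "letter_at w i a \<Longrightarrow> letter_at w i b \<Longrightarrow> a = b"
  by (simp add: letter_at_def)

lemma subseq_Cons_drop_iff:
  "subseq (a # as) (drop k w) \<longleftrightarrow> (\<exists>i \<ge> k. letter_at w i a \<and> subseq as (drop (Suc i) w))"
proof
  show "subseq (a # as) (drop k w) \<Longrightarrow> \<exists>i \<ge> k. letter_at w i a \<and> subseq as (drop (Suc i) w)"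
  proof (induction "length w - k" arbitrary: k)
    case (Suc n)
    then have "k < length w" by simp
    then have dr: "drop k w = w ! k # drop (Suc k) w" by (simp add: Cons_nth_drop_Suc)
    show ?case
    proof (cases "w ! k = a \<and> subseq as (drop (Suc k) w)")
      case True
      with \<open>k < length w\<close> show ?thesis by (auto simp: letter_at_def)
    next
      case False
      with Suc.prems dr have "subseq (a # as) (drop (Suc k) w)"
        by (auto split: if_splits)
      with Suc.hyps(1)[of "Suc k"] Suc.hyps(2) have
        "\<exists>i \<ge> Suc k. letter_at w i a \<and> subseq as (drop (Suc i) w)" by simp
      then show ?thesis using Suc_leD by blast
    qed
  qed simp
next
  assume "\<exists>i \<ge> k. letter_at w i a \<and> subseq as (drop (Suc i) w)"
  then obtain i where i: "k \<le> i" "i < length w" "w ! i = a" "subseq as (drop (Suc i) w)"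
    by (auto simp: letter_at_def)
  then have "subseq (a # as) (drop i w)"
    by (simp add: Cons_nth_drop_Suc[symmetric])
  moreover have "drop i w = drop (i - k) (drop k w)" using i(1) by simp
  ultimately show "subseq (a # as) (drop k w)"
    by (metis suffix_drop suffix_imp_subseq subseq_order.trans)
qed

lemma subseq1: "subseq [a] w \<longleftrightarrow> (\<exists>i. letter_at w i a)"
  using subseq_Cons_drop_iff[of a "[]" 0 w] by simp

lemma subseq2: "subseq [a, b] w \<longleftrightarrow> (\<exists>i j. i < j \<and> letter_at w i a \<and> letter_at w j b)"
  using subseq_Cons_drop_iff[of a "[b]" 0 w] by (fastforce simp: subseq_Cons_drop_iff Suc_le_eq)

lemma subseq3: "subseq [a, b, c] w \<longleftrightarrow>
  (\<exists>i j k. i < j \<and> j < k \<and> letter_at w i a \<and> letter_at w j b \<and> letter_at w k c)"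
  using subseq_Cons_drop_iff[of a "[b, c]" 0 w] by (fastforce simp: subseq_Cons_drop_iff Suc_le_eq)

lemma subseq4: "subseq [a, b, c, d] w \<longleftrightarrow>
  (\<exists>i j k l. i < j \<and> j < k \<and> k < l \<and> letter_at w i a \<and> letter_at w j b \<and> letter_at w k c \<and>
     letter_at w l d)"
  using subseq_Cons_drop_iff[of a "[b, c, d]" 0 w] by (fastforce simp: subseq_Cons_drop_iff Suc_le_eq)

lemma subseq5: "subseq [a, b, c, d, e] w \<longleftrightarrow>
  (\<exists>i j k l m. i < j \<and> j < k \<and> k < l \<and> l < m \<and> letter_at w i a \<and> letter_at w j b \<and>
     letter_at w k c \<and> letter_at w l d \<and> letter_at w m e)"
  using subseq_Cons_drop_iff[of a "[b, c, d, e]" 0 w] by (fastforce simp: subseq_Cons_drop_iff Suc_le_eq)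

text \<open>Send \<open>r\<close> and \<open>s\<close> to one letter and \<open>t\<close> to the other. If \<open>r t s\<close> were missing from
  \<open>v\<close>, the image of \<open>v\<close> would have height at most 4, so \<open>v\<close> contains \<open>r s t r\<close>; transferring
  \<open>r s r\<close> and \<open>s t\<close> back then makes the image of \<open>u\<close> too high.\<close>

lemma tight_subseq_transfer:
  assumes tight: "tight u v" and s: "count_list u s \<le> 1" and r: "count_list u r \<le> 2"
    and dist: "r \<noteq> s" "r \<noteq> t" "s \<noteq> t"
    and u4: "\<not> subseq [r, t, r, t] u" and v4: "\<not> subseq [r, t, r, t] v"
    and rts: "subseq [r, t, s] u"
  shows "subseq [r, t, s] v"
proof (rule ccontr)
  assume neg: "\<not> subseq [r, t, s] v"
  have "count_list v s \<le> 1" "count_list v r \<le> 2"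
    using tight_count_list[OF tight, of s] tight_count_list[OF tight, of r] s r by auto
  then have ss: "\<not> subseq [s, s] u" "\<not> subseq [s, s] v"
    and rrr: "\<not> subseq [r, r, r] u" "\<not> subseq [r, r, r] v"
    using s r subseq_replicate_iff[of 2 s] subseq_replicate_iff[of 3 r]
    by (auto simp: numeral_eq_Suc)
  have rs_iff: "subseq ps u \<longleftrightarrow> subseq ps v" if "distinct_adj ps" "set ps \<subseteq> {r, s}" for ps
  proof (rule tight_pair[OF tight dist(1) that])
    show "\<not> subseq [r, s, r, s, r] v" using rrr(2) unfolding subseq5 subseq3
      by (meson less_trans)
    show "\<not> subseq [s, r, s, r, s] v" using ss(2) unfolding subseq5 subseq2
      by (meson less_trans)
  qed
  have st_iff: "subseq ps u \<longleftrightarrow> subseq ps v" if "distinct_adj ps" "set ps \<subseteq> {s, t}" for ps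
  proof (rule tight_pair[OF tight dist(3) that])
    show "\<not> subseq [s, t, s, t, s] v" "\<not> subseq [t, s, t, s, t] v" using ss(2) unfolding subseq5 subseq2
      by (meson less_trans)+
  qed
  have "subseq [r, s] u" using rts unfolding subseq2 subseq3 by (meson less_trans)
  then have rs: "subseq [r, s] v" using rs_iff[of "[r, s]"] dist(1) by simp
  let ?K = "{r, s, t}" and ?f = "\<lambda>q. q \<noteq> t"
  note facts = neg ss(2) rrr(2) v4 rs
  note facts' = facts[unfolded subseq4 subseq2 subseq3]
  \<comment> \<open>There are at most two \<open>r\<close> and one \<open>s\<close>, and some
    \<open>r\<close> precedes \<open>s\<close>. Hence an alternation of length five would yield
    \<open>r t s\<close>, \<open>r t r t\<close>, a third \<open>r\<close> or a second
    \<open>s\<close>.\<close>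
  have avoid: "map ?f qs \<noteq> [True, False, True, False, True] \<and> map ?f qs \<noteq> [False, True, False, True, False]"
    if "subseq qs v" "set qs \<subseteq> ?K" for qs
  proof (intro conjI notI)
    assume "map ?f qs = [True, False, True, False, True]"
    then obtain a b c where abc: "qs = [a, t, b, t, c]" "a \<noteq> t" "b \<noteq> t" "c \<noteq> t"
      by (auto simp: map_eq_Cons_conv)
    with that have "a = r \<or> a = s" "b = r \<or> b = s" "c = r \<or> c = s" by auto
    moreover have "subseq [a, t, b, t, c] v" using abc that by simp
    ultimately show False
      using facts' unfolding subseq5
      by (smt (verit) less_trans linorder_neqE_nat letter_at_unique dist)
  next
    assume "map ?f qs = [False, True, False, True, False]"
    then obtain a b where abc: "qs = [t, a, t, b, t]" "a \<noteq> t" "b \<noteq> t"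
      by (auto simp: map_eq_Cons_conv)
    with that have "a = r \<or> a = s" "b = r \<or> b = s" by auto
    moreover have "subseq [t, a, t, b, t] v" using abc that by simp
    ultimately show False
      using facts' unfolding subseq5
      by (smt (verit) less_trans linorder_neqE_nat letter_at_unique dist)
  qed
  have pattern: "(\<exists>qs. subseq qs u \<and> set qs \<subseteq> ?K \<and> map ?f qs = ps) \<longleftrightarrow>
      (\<exists>qs. subseq qs v \<and> set qs \<subseteq> ?K \<and> map ?f qs = ps)" if "distinct_adj ps" for ps
    using tight_pattern[OF tight that, of ?K ?f] avoid by blast
  have "\<exists>qs. subseq qs u \<and> set qs \<subseteq> ?K \<and> map ?f qs = [True, False, True]"
    using rts dist by (intro exI[of _ "[r, t, s]"]) auto
  then obtain qs where qs: "subseq qs v" "set qs \<subseteq> ?K" "map ?f qs = [True, False, True]"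
    using pattern[of "[True, False, True]"] by (simp only: distinct_adj_Cons) fastforce
  then obtain a b where ab: "qs = [a, t, b]" "a \<noteq> t" "b \<noteq> t"
    by (auto simp: map_eq_Cons_conv)
  with qs have "a = r \<or> a = s" "b = r \<or> b = s" "subseq [a, t, b] v" by auto
  \<comment> \<open>The pattern found is \<open>r t r\<close> or \<open>s t r\<close>. The only
    \<open>s\<close> has an \<open>r\<close> before it and never follows an \<open>r t\<close>, so
    in both cases it lies between an \<open>r\<close> and the \<open>t\<close>.\<close>
  then have rstr: "subseq [r, s, t, r] v"
    using facts' unfolding subseq4 subseq3
    by (smt (verit) less_trans linorder_neqE_nat letter_at_unique dist)
  then have "subseq [r, s, r] v" "subseq [s, t] v"
    unfolding subseq4 subseq3 subseq2 by (meson less_trans)+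
  then have rsr: "subseq [r, s, r] u" and st: "subseq [s, t] u"
    using rs_iff[of "[r, s, r]"] st_iff[of "[s, t]"] dist by auto
  \<comment> \<open>In \<open>u\<close> the single \<open>s\<close> comes after \<open>r t\<close>
    and is followed by both a \<open>t\<close> and an \<open>r\<close>; if the \<open>r\<close> came
    first, \<open>r t r t\<close> would occur.\<close>
  have "subseq [r, t, s, t, r] u"
    using rsr st rts ss(1) rrr(1) u4 unfolding subseq5 subseq4 subseq3 subseq2
    by (smt (verit) less_trans linorder_neqE_nat letter_at_unique dist)
  then have "\<exists>qs. subseq qs u \<and> set qs \<subseteq> ?K \<and> map ?f qs = [True, False, True, False, True]"
    using dist by (intro exI[of _ "[r, t, s, t, r]"]) auto
  moreover have "distinct_adj [True, False, True, False, True]" by (simp add: distinct_adj_Cons)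
  ultimately show False using pattern avoid by metis
qed

subsection \<open>Zigzag words\<close>

text \<open>For \<open>L = {1..n}\<close> a zigzag word climbs from 1 to \<open>n\<close> through all of \<open>L\<close>, goes down to 1
  through some subset of \<open>L\<close>, and climbs again; \<open>descent\<close> picks out the inner letters of
  that subset. Letters are integers so that reversing words can be combined with negating
  letters.\<close>

definition zigzag :: "int set \<Rightarrow> int list \<Rightarrow> bool" where
  "zigzag L w \<longleftrightarrow> (\<forall>i \<in> L. \<forall>j \<in> L. i < j \<longrightarrow> subseq [i, j, i, j] w) \<and>
     (\<forall>a b a' b'. max a a' < min b b' \<longrightarrow> \<not> subseq [b, a, b', a'] w)"

definition descent :: "int list \<Rightarrow> int \<Rightarrow> bool" where
  "descent w d \<longleftrightarrow> (\<exists>i j. i < d \<and> d < j \<and> subseq [j, d, i] w)"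

text \<open>Letters outside this set come only from variables with at most two occurrences, whose
  number is controlled by \<open>tight_count_list\<close>. In zigzag images the set is small, by
  \<open>card_frequent\<close>.\<close>

definition frequent :: "(var \<Rightarrow> 'c list) \<Rightarrow> word \<Rightarrow> 'c set" where
  "frequent \<theta> u = (\<Union>t \<in> {t. 3 \<le> count_list u t}. set (\<theta> t))"

lemma zigzag_subseq: "zigzag L w \<Longrightarrow> i \<in> L \<Longrightarrow> j \<in> L \<Longrightarrow> i < j \<Longrightarrow> subseq [i, j, i, j] w"
  by (simp add: zigzag_def)

lemma zigzag_not_subseq:
  "zigzag L w \<Longrightarrow> a < b \<Longrightarrow> a < b' \<Longrightarrow> a' < b \<Longrightarrow> a' < b' \<Longrightarrow> \<not> subseq [b, a, b', a'] w"
  by (simp add: zigzag_def)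

text \<open>Take a \<open>k\<close> that stands between two \<open>d\<close>. If it came after the
  \<open>d\<close> of \<open>j d i\<close>, then \<open>j d k i\<close> or \<open>j i k d\<close>
  would occur, both forbidden. With its mirror image below, this frees the witnesses of
  \<open>descent\<close>: any letters of \<open>L\<close> on the two sides of \<open>d\<close> will
  do.\<close>

lemma descent_upper:
  assumes w: "zigzag L w" and "d \<in> L" "k \<in> L" "i < d" "d < j" "d < k" and jdi: "subseq [j, d, i] w"
  shows "subseq [k, d, i] w"
proof -
  have "subseq [d, k, d, k] w" using assms by (intro zigzag_subseq[OF w])
  moreover have "\<not> subseq [j, i, k, d] w" "\<not> subseq [j, d, k, i] w"
    using assms by (intro zigzag_not_subseq[OF w]; simp)+
  ultimately show ?thesis
    using jdi assms(4-6) unfolding subseq4 subseq3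
    by (smt (verit) less_trans linorder_neqE_nat letter_at_unique)
qed

lemma descent_lower:
  assumes w: "zigzag L w" and "d \<in> L" "k \<in> L" "i < d" "d < j" "k < d" and jdi: "subseq [j, d, i] w"
  shows "subseq [j, d, k] w"
proof -
  have "subseq [k, d, k, d] w" using assms by (intro zigzag_subseq[OF w])
  moreover have "\<not> subseq [j, k, d, i] w" "\<not> subseq [d, k, j, i] w"
    using assms by (intro zigzag_not_subseq[OF w]; simp)+
  ultimately show ?thesis
    using jdi assms(4-6) unfolding subseq4 subseq3
    by (smt (verit) less_trans linorder_neqE_nat letter_at_unique)
qed

lemma descent_subseq:
  assumes "zigzag L w" and "d \<in> L" "i \<in> L" "j \<in> L" "i < d" "d < j" "descent w d"
  shows "subseq [j, d, i] w"
proof -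
  from assms(7) obtain i' j' where ij: "i' < d" "d < j'" "subseq [j', d, i'] w"
    by (auto simp: descent_def)
  from descent_upper[OF assms(1,2,4) ij(1,2) assms(6) ij(3)]
  show ?thesis using assms ij(1) by (intro descent_lower[of L w d i i' j])
qed

section \<open>Tracing letters of an image back to variables\<close>

lemma subst_word_eq_append_ConsD:
  "subst_word \<theta> u = w1 @ e # w2 \<Longrightarrow>
   \<exists>p s q \<alpha> \<beta>. u = p @ s # q \<and> \<theta> s = \<alpha> @ e # \<beta> \<and> w1 = subst_word \<theta> p @ \<alpha> \<and> w2 = \<beta> @ subst_word \<theta> q"
proof (induction u arbitrary: w1)
  case (Cons a u)
  then have "\<theta> a @ subst_word \<theta> u = w1 @ e # w2" by simp
  then consider \<beta> where "\<theta> a = w1 @ e # \<beta>" "w2 = \<beta> @ subst_word \<theta> u"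
    | w1' where "w1 = \<theta> a @ w1'" "subst_word \<theta> u = w1' @ e # w2"
    by (auto simp: append_eq_append_conv2 append_eq_Cons_conv Cons_eq_append_conv)
  then show ?case
  proof cases
    case 1
    then show ?thesis by (intro exI[of _ "[]"] exI[of _ a] exI[of _ u] exI[of _ w1] exI[of _ \<beta>]) simp
  next
    case 2
    from Cons.IH[OF 2(2)] obtain p s q \<alpha> \<beta> where "u = p @ s # q" "\<theta> s = \<alpha> @ e # \<beta>"
      "w1' = subst_word \<theta> p @ \<alpha>" "w2 = \<beta> @ subst_word \<theta> q" by blast
    with 2(1) show ?thesis
      by (intro exI[of _ "a # p"] exI[of _ s] exI[of _ q] exI[of _ \<alpha>] exI[of _ \<beta>]) simp
  qed
qed simp

lemma subseq_Cons_iff_split: "subseq (a # as) w \<longleftrightarrow> (\<exists>w1 w2. w = w1 @ a # w2 \<and> subseq as w2)"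
proof
  show "subseq (a # as) w \<Longrightarrow> \<exists>w1 w2. w = w1 @ a # w2 \<and> subseq as w2"
    by (rule list_emb_ConsD[THEN exE]) auto
qed (auto intro: subseq_drop_many)

lemma subseq_middle_split:
  "subseq [a, b, c] w \<longleftrightarrow> (\<exists>w1 w2. w = w1 @ b # w2 \<and> a \<in> set w1 \<and> c \<in> set w2)"
proof
  assume "subseq [a, b, c] w"
  then obtain x y z where "w = x @ a # y @ b # z" "c \<in> set z"
    by (auto simp: subseq_Cons_iff_split[of a] subseq_Cons_iff_split[of b] subseq_singleton_left)
  then show "\<exists>w1 w2. w = w1 @ b # w2 \<and> a \<in> set w1 \<and> c \<in> set w2"
    by (intro exI[of _ "x @ a # y"] exI[of _ z]) auto
next
  assume "\<exists>w1 w2. w = w1 @ b # w2 \<and> a \<in> set w1 \<and> c \<in> set w2"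
  then obtain w1 w2 where "w = w1 @ b # w2" "subseq [a] w1" "subseq [c] w2"
    by (auto simp: subseq_singleton_left)
  then show "subseq [a, b, c] w"
    using list_emb_append_mono[of "(=)" "[a]" w1 "[b, c]" "b # w2"] by simp
qed

lemma subseq2_subst_wordD:
  assumes "subseq [a, b] (subst_word \<theta> p)"
  shows "(\<exists>r. r \<in> set p \<and> subseq [a, b] (\<theta> r)) \<or> (\<exists>r t. subseq [r, t] p \<and> a \<in> set (\<theta> r) \<and> b \<in> set (\<theta> t))"
proof -
  from assms obtain w1 w2 where w: "subst_word \<theta> p = w1 @ a # w2" "b \<in> set w2"
    by (auto simp: subseq_Cons_iff_split[of a] subseq_singleton_left)
  from subst_word_eq_append_ConsD[OF w(1)] obtain x r y \<alpha> \<beta> where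
    p: "p = x @ r # y" "\<theta> r = \<alpha> @ a # \<beta>" "w2 = \<beta> @ subst_word \<theta> y" by blast
  show ?thesis
  proof (cases "b \<in> set \<beta>")
    case True
    then have "subseq [a, b] (\<theta> r)" by (auto simp: p(2) subseq_Cons_iff_split[of a] subseq_singleton_left)
    then show ?thesis using p(1) by auto
  next
    case False
    with w(2) p(3) obtain t where t: "t \<in> set y" "b \<in> set (\<theta> t)" by auto
    then have "subseq [r, t] p"
      unfolding subseq_Cons_iff_split[of r] p(1) subseq_singleton_left by blast
    moreover have "a \<in> set (\<theta> r)" using p(2) by simp
    ultimately show ?thesis using t(2) by blast
  qed
qed

lemma append_Cons_eq_append_ConsD:
  "xs @ a # ys = zs @ b # us \<Longrightarrow> a \<noteq> b \<Longrightarrow> (\<exists>r. zs = xs @ a # r) \<or> (\<exists>r. xs = zs @ b # r)"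
  by (auto simp: append_eq_append_conv2 append_eq_Cons_conv Cons_eq_append_conv)

lemma card_infrequent_positions:
  assumes "finite X" "set u \<subseteq> X"
  shows "card {k. k < length u \<and> count_list u (u ! k) \<le> c} \<le> c * card X"
proof -
  let ?A = "\<lambda>s. {k. k < length u \<and> u ! k = s}"
  let ?X = "{s \<in> X. count_list u s \<le> c}"
  have cardA: "card (?A s) = count_list u s" for s
  proof -
    have "?A s = {k. k < length u \<and> s = u ! k}" by auto
    then show ?thesis
      by (simp add: count_list_eq_length_filter length_filter_conv_card)
  qed
  have "{k. k < length u \<and> count_list u (u ! k) \<le> c} = (\<Union>s \<in> ?X. ?A s)"
    using assms(2) by (auto dest: nth_mem)
  then have "card {k. k < length u \<and> count_list u (u ! k) \<le> c} \<le> (\<Sum>s \<in> ?X. card (?A s))"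
    using assms(1) by (simp only:) (rule card_UN_le, simp)
  also have "\<dots> \<le> (\<Sum>s \<in> ?X. c)" unfolding cardA by (rule sum_mono) simp
  also have "\<dots> = card ?X * c" by simp
  also have "\<dots> \<le> card X * c" using assms(1) by (intro mult_le_mono1 card_mono) auto
  finally show ?thesis by (simp add: mult.commute)
qed

text \<open>More letters \<open>e \<in> B\<close> occur in the descending part than there are positions in \<open>u\<close> of variables
  with at most two occurrences, so two of them, \<open>e > e'\<close>, come from the same position. Its variable
  \<open>s\<close> occurs only once in \<open>u\<close>, since twice would create the forbidden \<open>e e' e e'\<close>.\<close>

lemma descent_step_below:
  assumes tight: "tight u v"
    and w: "zigzag L (subst_word \<theta> u)" and w': "zigzag L (subst_word \<theta> v)"
    and X: "finite X" "set u \<subseteq> X" "2 * card X < card B"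
    and L: "d \<in> L" "j \<in> L" "l \<in> L" "B \<subseteq> L" and j: "d < j" "j \<notin> frequent \<theta> u"
    and B: "\<And>e. e \<in> B \<Longrightarrow> l < e \<and> e < d \<and> e \<notin> frequent \<theta> u \<and> descent (subst_word \<theta> u) e"
    and d: "descent (subst_word \<theta> u) d"
  shows "descent (subst_word \<theta> v) d"
proof -
  let ?w = "subst_word \<theta> u"
  \<comment> \<open>The occurrence of the variable \<open>s\<close> at position \<open>k\<close> of
    \<open>u\<close> produces an \<open>e\<close> lying between a \<open>j\<close> and an
    \<open>l\<close>, that is, in the descending part.\<close>
  let ?slot = "\<lambda>e k. \<exists>p s q \<alpha> \<beta>. u = p @ s # q \<and> \<theta> s = \<alpha> @ e # \<beta> \<and>
    j \<in> set (subst_word \<theta> p @ \<alpha>) \<and> l \<in> set (\<beta> @ subst_word \<theta> q) \<and> length p = k"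
  have "\<exists>k. ?slot e k" if "e \<in> B" for e
  proof -
    have "subseq [j, e, l] ?w"
      using B[OF that(1)] L that(1) j by (intro descent_subseq[OF w]) auto
    then obtain w1 w2 where "?w = w1 @ e # w2" "j \<in> set w1" "l \<in> set w2"
      unfolding subseq_middle_split by blast
    then show ?thesis using subst_word_eq_append_ConsD[of \<theta> u w1 e w2] by blast
  qed
  then obtain K where K: "\<And>e. e \<in> B \<Longrightarrow> ?slot e (K e)"
    using bchoice[of B ?slot] by blast
  have "K ` B \<subseteq> {k. k < length u \<and> count_list u (u ! k) \<le> 2}"
  proof
    fix k assume "k \<in> K ` B"
    then obtain e where e: "e \<in> B" "k = K e" by blast
    from K[OF e(1)] e(2) obtain p s q \<alpha> \<beta> where "u = p @ s # q" "\<theta> s = \<alpha> @ e # \<beta>" "length p = k"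
      by metis
    then have "e \<in> set (\<theta> s)" "u ! k = s" "k < length u" by (auto simp: nth_append)
    moreover from this B[OF e(1)] have "\<not> 3 \<le> count_list u s" unfolding frequent_def by blast
    ultimately show "k \<in> {k. k < length u \<and> count_list u (u ! k) \<le> 2}" by simp
  qed
  then have "card (K ` B) \<le> card {k. k < length u \<and> count_list u (u ! k) \<le> 2}"
    by (rule card_mono[rotated]) simp
  also have "\<dots> < card B" using card_infrequent_positions[OF X(1,2), of 2] X(3) by simp
  finally have "\<not> inj_on K B" using card_image[of K B] by linarith
  then obtain e e' where e: "e \<in> B" "e' \<in> B" "e' < e" "K e = K e'"
    unfolding inj_on_def by (metis linorder_neqE)
  from K[OF e(1)] obtain p s q \<alpha> \<beta> where u: "u = p @ s # q" and s: "\<theta> s = \<alpha> @ e # \<beta>"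
    and jl: "j \<in> set (subst_word \<theta> p @ \<alpha>)" "l \<in> set (\<beta> @ subst_word \<theta> q)" and p: "length p = K e"
    by blast
  from K[OF e(2)] obtain p' s' q' \<alpha>' \<beta>' where u': "u = p' @ s' # q'" and s': "\<theta> s' = \<alpha>' @ e' # \<beta>'"
    and jl': "j \<in> set (subst_word \<theta> p' @ \<alpha>')" and p': "length p' = K e'"
    by blast
  have eqs: "p' = p" "s' = s" "q' = q" using u u' p p' e(4) by auto
  have lee: "l < e'" "e' < e" "e < d" "d < j" using B e j by auto
  have "\<alpha> @ e # \<beta> = \<alpha>' @ e' # \<beta>'" using s s' eqs by simp
  then consider x where "\<beta> = x @ e' # \<beta>'" | x where "\<alpha> = \<alpha>' @ e' # x"
    using lee(2) by (auto simp: append_eq_append_conv2 append_eq_Cons_conv Cons_eq_append_conv)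
  then have ee: "subseq [e, e'] (\<theta> s)"
  proof cases
    case 1
    then show ?thesis
      unfolding s subseq_Cons_iff_split[of e] subseq_singleton_left
      by (intro exI[of _ \<alpha>] exI[of _ \<beta>]) simp
  next
    case 2
    \<comment> \<open>With \<open>e'\<close> before \<open>e\<close> the image would contain
      \<open>j e' e l\<close>, which a zigzag word avoids.\<close>
    have "?w = (subst_word \<theta> p @ \<alpha>') @ e' # x @ e # (\<beta> @ subst_word \<theta> q)"
      using u s 2 by simp
    moreover have "subseq [j] (subst_word \<theta> p @ \<alpha>')" "subseq [l] (\<beta> @ subst_word \<theta> q)"
      using jl' jl eqs unfolding subseq_singleton_left by auto
    ultimately have "subseq [j, e', e, l] ?w"
      using list_emb_append_mono[of "(=)" "[j]" "subst_word \<theta> p @ \<alpha>'" "[e', e, l]"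
          "e' # x @ e # (\<beta> @ subst_word \<theta> q)"] by (simp add: subseq_drop_many)
    then show ?thesis using zigzag_not_subseq[OF w, of e' j e l] lee by auto
  qed
  have ss: "\<not> subseq [s, s] u"
  proof
    assume "subseq [s, s] u"
    from subseq_subst_word[OF this, of \<theta> "[[e, e'], [e, e']]"] ee
    have "subseq [e, e', e, e'] ?w" by simp
    then show False using zigzag_not_subseq[OF w, of e' e e e'] lee by auto
  qed
  then have count_s: "count_list u s \<le> 1"
    using subseq_replicate_iff[of 2 s u] by (auto simp: numeral_eq_Suc)
  then have count_s': "count_list v s = count_list u s"
    using tight_count_list[OF tight, of s] by simp
  then have ss': "\<not> subseq [s, s] v"
    using count_s subseq_replicate_iff[of 2 s v] by (auto simp: numeral_eq_Suc)
  have sv: "s \<in> set v"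
    using count_s' u count_notin[of s v] by fastforce
  have sp: "s \<notin> set p" using count_s u by (auto simp: count_list_0_iff)
  have e_s: "subseq [e] (\<theta> s)" using s by (auto simp: subseq_singleton_left)
  have jdl: "subseq [j, d, l] ?w"
    using L j lee d by (intro descent_subseq[OF w]) auto
  then obtain w1 w2 where w12: "?w = w1 @ d # w2" "j \<in> set w1" "l \<in> set w2"
    unfolding subseq_middle_split by blast
  have w_eq: "?w = (subst_word \<theta> p @ \<alpha>) @ e # (\<beta> @ subst_word \<theta> q)" using u s by simp
  \<comment> \<open>The descending \<open>d\<close> precedes the chosen \<open>e\<close>, since
    otherwise \<open>j e d l\<close> would occur. So \<open>j d\<close> lies before that
    \<open>e\<close>.\<close>
  then have "w1 @ d # w2 = (subst_word \<theta> p @ \<alpha>) @ e # (\<beta> @ subst_word \<theta> q)" using w12 by simp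
  then consider x where "subst_word \<theta> p @ \<alpha> = w1 @ d # x" | x where "w1 = (subst_word \<theta> p @ \<alpha>) @ e # x"
    using append_Cons_eq_append_ConsD[of w1 d w2 "subst_word \<theta> p @ \<alpha>" e] lee(3) by blast
  then have jd: "subseq [j, d] (subst_word \<theta> p @ \<alpha>)"
  proof cases
    case 1
    then show ?thesis
      using w12(2) list_emb_append_mono[of "(=)" "[j]" w1 "[d]" "d # x"]
      by (simp add: subseq_singleton_left)
  next
    case 2
    then have "?w = (subst_word \<theta> p @ \<alpha>) @ e # x @ d # w2" using w12 by simp
    moreover have "subseq [j] (subst_word \<theta> p @ \<alpha>)" "subseq [l] w2"
      using jl w12 unfolding subseq_singleton_left by auto
    ultimately have "subseq [j, e, d, l] ?w"
      using list_emb_append_mono[of "(=)" "[j]" "subst_word \<theta> p @ \<alpha>" "[e, d, l]" "e # x @ d # w2"]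
      by (simp add: subseq_drop_many)
    then show ?thesis using zigzag_not_subseq[OF w, of e j d l] lee by auto
  qed
  \<comment> \<open>The smaller letter \<open>e\<close> itself serves as lower witness in the image
    of \<open>v\<close>, so it is enough to carry \<open>j d e\<close> over.\<close>
  have goal: ?thesis if "subseq [j, d, e] (subst_word \<theta> v)"
    using that lee unfolding descent_def by blast
  have rs_iff: "subseq ps u \<longleftrightarrow> subseq ps v"
    if "r \<noteq> s" "distinct_adj ps" "set ps \<subseteq> {r, s}" for r ps
  proof (rule tight_pair[OF tight that])
    show "\<not> subseq [r, s, r, s, r] v" "\<not> subseq [s, r, s, r, s] v"
      using ss' unfolding subseq5 subseq2 by (meson less_trans)+
  qed
  have rs_case: ?thesis if "r \<in> set p" "subseq xs (\<theta> r)" "subseq ys (\<theta> s)" "xs @ ys = [j, d, e]" for r xs ys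
  proof -
    have "subseq [r, s] u"
      using that(1) list_emb_append_mono[of "(=)" "[r]" p "[s]" "s # q"]
      unfolding u by (simp add: subseq_singleton_left)
    moreover have "r \<noteq> s" using that(1) sp by auto
    ultimately have "subseq [r, s] v" using rs_iff[of r "[r, s]"] by simp
    from subseq_subst_word[OF this, of \<theta> "[xs, ys]"] that show ?thesis by (intro goal) simp
  qed
  \<comment> \<open>Either \<open>s\<close> yields all of \<open>j d e\<close>, or one earlier
    variable yields what is missing, or \<open>j\<close> and \<open>d\<close> come from successive
    occurrences \<open>r t\<close> before \<open>s\<close>. Only the last case calls for more than
    pairs of variables.\<close>
  from jd consider "subseq [j, d] \<alpha>" | "j \<in> set (subst_word \<theta> p)" "d \<in> set \<alpha>" | "subseq [j, d] (subst_word \<theta> p)"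
    unfolding subseq_append_iff by (auto simp: Cons_eq_append_conv subseq_singleton_left)
  then show ?thesis
  proof cases
    case 1
    then have "subseq [j, d, e] (\<theta> s)"
      using list_emb_append_mono[of "(=)" "[j, d]" \<alpha> "[e]" "e # \<beta>"] s by simp
    moreover have "subseq [s] v" using sv by (simp add: subseq_singleton_left)
    ultimately show ?thesis
      using subseq_subst_word[of "[s]" v \<theta> "[[j, d, e]]"] by (intro goal) simp
  next
    case 2
    then obtain r where "r \<in> set p" "subseq [j] (\<theta> r)" by (auto simp: subseq_singleton_left)
    moreover have "subseq [d, e] (\<theta> s)"
      using 2(2) list_emb_append_mono[of "(=)" "[d]" \<alpha> "[e]" "e # \<beta>"] s
      by (simp add: subseq_singleton_left)
    ultimately show ?thesis using rs_case[of r "[j]" "[d, e]"] by simp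
  next
    case 3
    from subseq2_subst_wordD[OF this] consider r where "r \<in> set p" "subseq [j, d] (\<theta> r)"
      | r t where "subseq [r, t] p" "j \<in> set (\<theta> r)" "d \<in> set (\<theta> t)" by blast
    then show ?thesis
    proof cases
      case 1
      then show ?thesis using rs_case[of r "[j, d]" "[e]"] e_s by simp
    next
      case 2
      have rts: "subseq [r, t, s] u"
        using 2(1) list_emb_append_mono[of "(=)" "[r, t]" p "[s]" "s # q"] unfolding u by simp
      have count_r: "count_list u r \<le> 2"
        using 2(2) j(2) by (force simp: frequent_def not_le)
      have "r \<in> set p" "t \<in> set p" using set_mono_subseq[OF 2(1)] by auto
      then have ne: "r \<noteq> s" "t \<noteq> s" using sp by auto
      have rt4: "\<not> subseq [r, t, r, t] z" if z: "zigzag L (subst_word \<theta> z)" for z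
      proof
        assume "subseq [r, t, r, t] z"
        from subseq_subst_word[OF this, of \<theta> "[[j], [d], [j], [d]]"] 2(2,3)
        have "subseq [j, d, j, d] (subst_word \<theta> z)" by (simp add: subseq_singleton_left)
        then show False using zigzag_not_subseq[OF z, of d j j d] lee by auto
      qed
      have "subseq [r, t, s] v"
      proof (cases "r = t")
        case False
        then show ?thesis
          using tight_subseq_transfer[OF tight count_s count_r] ne rt4[OF w] rt4[OF w'] rts by blast
      next
        case True
        \<comment> \<open>For \<open>r = t\<close>, both occurrences of \<open>r\<close> in
          \<open>u\<close> precede \<open>s\<close>. Hence \<open>s r\<close> is absent from
          \<open>u\<close>, so also from \<open>v\<close>, and the two \<open>r\<close> in
          \<open>v\<close> again precede \<open>s\<close>.\<close>
        have "subseq [r, r] u" using True rts unfolding subseq2 subseq3 by blast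
        then have "count_list u r = 2"
          using count_r subseq_replicate_iff[of 2 r u] by (auto simp: numeral_eq_Suc)
        then have rr: "subseq [r, r] v" and rrr: "\<not> subseq [r, r, r] u"
          using tight_count_list[OF tight, of r] subseq_replicate_iff[of 2 r v]
            subseq_replicate_iff[of 3 r u] by (auto simp: numeral_eq_Suc)
        have "\<not> subseq [s, r] u"
          using rts rrr ss True ne unfolding subseq2 subseq3
          by (smt (verit) less_trans linorder_neqE_nat letter_at_unique)
        then have "\<not> subseq [s, r] v" using rs_iff[of r "[s, r]"] ne by auto
        moreover have "subseq [s] v" using sv by (simp add: subseq_singleton_left)
        ultimately show ?thesis
          using rr True ne unfolding subseq1 subseq2 subseq3
          by (smt (verit) less_trans linorder_neqE_nat letter_at_unique)
      qed
      from subseq_subst_word[OF this, of \<theta> "[[j], [d], [e]]"] 2(2,3) e_s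
      show ?thesis by (intro goal) (simp add: subseq_singleton_left)
    qed
  qed
qed

section \<open>Mirror symmetry: reversing words and negating letters\<close>

lemma subseq_map_inj_iff:
  assumes "inj f"
  shows "subseq (map f xs) (map f ys) \<longleftrightarrow> subseq xs ys"
  using assms unfolding subseq_map_iff by (auto simp: inj_map_eq_map)

lemma subseq_rev_map_uminus_iff:
  fixes w :: "int list"
  shows "subseq xs (rev (map uminus w)) \<longleftrightarrow> subseq (rev (map uminus xs)) w"
proof -
  have "subseq xs (rev (map uminus w)) \<longleftrightarrow> subseq (map uminus (rev (map uminus xs))) (map uminus w)"
    unfolding subseq_rev_iff by (simp add: rev_map comp_def)
  also have "\<dots> \<longleftrightarrow> subseq (rev (map uminus xs)) w"
    by (rule subseq_map_inj_iff) (simp add: inj_def)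
  finally show ?thesis .
qed

lemma zigzag_rev_map_uminus:
  assumes "zigzag L w"
  shows "zigzag (uminus ` L) (rev (map uminus w))"
  unfolding zigzag_def subseq_rev_map_uminus_iff
  using zigzag_subseq[OF assms] zigzag_not_subseq[OF assms] by auto

lemma descent_rev_map_uminus_iff: "descent (rev (map uminus w)) (- d) \<longleftrightarrow> descent w d"
proof
  assume "descent (rev (map uminus w)) (- d)"
  then obtain i j where "i < - d" "- d < j" "subseq [- i, d, - j] w"
    by (auto simp: descent_def subseq_rev_map_uminus_iff)
  then show "descent w d" unfolding descent_def by (intro exI[of _ "- j"] exI[of _ "- i"]) simp
next
  assume "descent w d"
  then obtain i j where "i < d" "d < j" "subseq [j, d, i] w"
    by (auto simp: descent_def)
  then show "descent (rev (map uminus w)) (- d)"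
    unfolding descent_def subseq_rev_map_uminus_iff by (intro exI[of _ "- j"] exI[of _ "- i"]) simp
qed

text \<open>Reversing words and negating letters preserves zigzag words and descents and swaps above
  with below, so this is \<open>descent_step_below\<close> for the mirror image.\<close>

lemma descent_step_above:
  assumes tight: "tight u v"
    and w: "zigzag L (subst_word \<theta> u)" and w': "zigzag L (subst_word \<theta> v)"
    and X: "finite X" "set u \<subseteq> X" "2 * card X < card B"
    and L: "d \<in> L" "i \<in> L" "l \<in> L" "B \<subseteq> L" and i: "i < d" "i \<notin> frequent \<theta> u"
    and B: "\<And>e. e \<in> B \<Longrightarrow> e < l \<and> d < e \<and> e \<notin> frequent \<theta> u \<and> descent (subst_word \<theta> u) e"
    and d: "descent (subst_word \<theta> u) d"
  shows "descent (subst_word \<theta> v) d"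
proof -
  let ?\<theta> = "\<lambda>t. rev (map uminus (\<theta> t))"
  have subst: "subst_word ?\<theta> (rev z) = rev (map uminus (subst_word \<theta> z))" for z
    by (induction z) auto
  have freq: "frequent ?\<theta> (rev u) = uminus ` frequent \<theta> u"
    by (simp add: frequent_def image_UN)
  have "card (uminus ` B) = card B" by (rule card_image) (simp add: inj_on_def)
  then have "descent (subst_word ?\<theta> (rev v)) (- d)"
    using assms by (intro descent_step_below[of "rev u" "rev v" "uminus ` L" ?\<theta> X "uminus ` B" _ "- i" "- l"])
      (auto simp: tight_rev subst zigzag_rev_map_uminus descent_rev_map_uminus_iff freq)
  then show ?thesis unfolding subst descent_rev_map_uminus_iff .
qed

text \<open>If the image of a variable with three occurrences contained letters
  \<open>i < j\<close>, in whichever order, three copies of it would contain the forbidden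
  \<open>j i j i\<close>. So each such variable contributes at most one letter.\<close>

lemma card_frequent:
  assumes w: "zigzag L (subst_word \<theta> u)" and X: "finite X" "set u \<subseteq> X"
  shows "finite (frequent \<theta> u)" "card (frequent \<theta> u) \<le> card X"
proof -
  let ?F = "{t. 3 \<le> count_list u t}"
  have sub: "?F \<subseteq> X" using X(2) count_notin by fastforce
  then have fin: "finite ?F" using X(1) finite_subset by blast
  then show "finite (frequent \<theta> u)" by (simp add: frequent_def)
  have one: "card (set (\<theta> t)) \<le> 1" if "3 \<le> count_list u t" for t
  proof -
    have ttt: "subseq [t, t, t] u"
      using that subseq_replicate_iff[of 3 t u] by (simp add: numeral_eq_Suc)
    have False if "i < j" "i \<in> set (\<theta> t)" "j \<in> set (\<theta> t)" for i j
    proof -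
      have "subseq [i, j] (\<theta> t) \<or> subseq [j, i] (\<theta> t)"
        using that unfolding subseq2 by (metis in_set_conv_nth letter_at_def less_irrefl linorder_neqE_nat)
      then have "subseq [j, i, j, i] (subst_word \<theta> u)"
      proof
        assume "subseq [i, j] (\<theta> t)"
        with subseq_subst_word[OF ttt, of \<theta> "[[j], [i, j], [i]]"] that(2,3)
        show ?thesis by (simp add: subseq_singleton_left)
      next
        assume "subseq [j, i] (\<theta> t)"
        with subseq_subst_word[OF ttt, of \<theta> "[[j, i], [j, i], []]"] show ?thesis by simp
      qed
      then show False using zigzag_not_subseq[OF w, of i j j i] that(1) by simp
    qed
    then have "i = j" if "i \<in> set (\<theta> t)" "j \<in> set (\<theta> t)" for i j
      using that by (meson linorder_neqE)
    then show ?thesis by (auto simp: card_le_Suc0_iff_eq)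
  qed
  have "card (frequent \<theta> u) \<le> (\<Sum>t \<in> ?F. card (set (\<theta> t)))"
    unfolding frequent_def using fin by (rule card_UN_le)
  also have "\<dots> \<le> (\<Sum>t \<in> ?F. 1)" using one by (intro sum_mono) simp
  also have "\<dots> \<le> card X" using card_mono[OF X(1) sub] by simp
  finally show "card (frequent \<theta> u) \<le> card X" .
qed

text \<open>An inner \<open>d\<close> has more than \<open>card X\<close> letters on each side, so
  an infrequent one is available as \<open>j\<close> or \<open>i\<close>. The larger side of
  \<open>d\<close> holds at least \<open>3 * card X + 3\<close> inner letters, of which more than
  \<open>2 * card X\<close> are infrequent; these form \<open>B\<close>.\<close>

lemma descents_preserved:
  fixes n :: int
  assumes tight: "tight u v"
    and w: "zigzag {1..n} (subst_word \<theta> u)" and w': "zigzag {1..n} (subst_word \<theta> v)"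
    and X: "finite X" "set u \<subseteq> X" and n: "8 * int (card X) + 10 \<le> n"
    and desc: "\<And>d. d \<in> {int (card X) + 2..n - int (card X) - 1} \<Longrightarrow> descent (subst_word \<theta> u) d"
    and d: "d \<in> {int (card X) + 2..n - int (card X) - 1}"
  shows "descent (subst_word \<theta> v) d"
proof -
  let ?m = "int (card X)" and ?T = "frequent \<theta> u"
  have T: "finite ?T" "card ?T \<le> card X" using card_frequent[OF w X] by auto
  have big: "card A - card X \<le> card (A - ?T)" for A
    using diff_card_le_card_Diff[OF T(1), of A] T(2) by linarith
  have ex: "\<exists>k \<in> A. k \<notin> ?T" if "card X < card A" for A
  proof -
    have "card (A - ?T) \<noteq> 0" using big[of A] that by linarith
    then have "A - ?T \<noteq> {}" by (metis card.empty)
    then show ?thesis by blast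
  qed
  show ?thesis
  proof (cases "2 * d \<ge> n")
    case True
    have "card X < card {d + 1..n}" using d by (simp add: zless_nat_eq_int_zless)
    then obtain j where j: "j \<in> {d + 1..n}" "j \<notin> ?T" using ex by blast
    let ?B = "{?m + 2..d - 1} - ?T"
    have "2 * card X < card {?m + 2..d - 1} - card X" using True n d by simp
    then have "2 * card X < card ?B" using big[of "{?m + 2..d - 1}"] by linarith
    then show ?thesis using j d desc n
      by (intro descent_step_below[OF tight w w' X, of ?B d j 1]) auto
  next
    case False
    have "card X < card {1..d - 1}" using d by (simp add: zless_nat_eq_int_zless)
    then obtain i where i: "i \<in> {1..d - 1}" "i \<notin> ?T" using ex by blast
    let ?B = "{d + 1..n - ?m - 1} - ?T"
    have "2 * card X < card {d + 1..n - ?m - 1} - card X" using False n d by simp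
    then have "2 * card X < card ?B" using big[of "{d + 1..n - ?m - 1}"] by linarith
    then show ?thesis using i d desc n
      by (intro descent_step_above[OF tight w w' X, of ?B d i n]) auto
  qed
qed

section \<open>The two sides of the identities in the theorem\<close>

lemma sorted_wrt_subseq: "subseq xs ys \<Longrightarrow> sorted_wrt P ys \<Longrightarrow> sorted_wrt P xs"
proof (induction rule: list_emb.induct)
  case (list_emb_Cons2 x y xs ys)
  then show ?case using set_mono_subseq[of xs ys] by auto
qed auto

definition up_down_up :: "nat \<Rightarrow> word" where
  "up_down_up n = [1..<n+1] @ rev [1..<n+1] @ [1..<n+1]"

lemma subseq_upt: "i < j \<Longrightarrow> a \<le> i \<Longrightarrow> j < b \<Longrightarrow> subseq [i, j] [a..<b]"
  unfolding subseq2 letter_at_def by (intro exI[of _ "i - a"] exI[of _ "j - a"]) auto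

lemma up_down_up_subseq:
  assumes "1 \<le> i" "i < j" "j \<le> n"
  shows "subseq [i, j, i, j] (up_down_up n)"
proof -
  have "subseq [i, j] [1..<n+1]" using assms by (intro subseq_upt) auto
  from list_emb_append_mono[OF this subseq_drop_many[OF this]] show ?thesis
    by (simp add: up_down_up_def)
qed

text \<open>Both \<open>b a\<close> and \<open>b' a'\<close> are drops, so each climb takes at most
  one of the four letters, and the descent would have to contain the rise
  \<open>a b'\<close>.\<close>

lemma up_down_up_not_subseq:
  assumes "a < b" "a < b'" "a' < b" "a' < b'"
  shows "\<not> subseq [b, a, b', a'] (up_down_up n)"
proof
  have up: "sorted_wrt (<) xs" if "subseq xs [1..<n+1]" for xs
    using sorted_wrt_subseq[OF that sorted_wrt_upt] .
  have down: "sorted_wrt (>) xs" if "subseq xs (rev [1..<n+1])" for xs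
    by (rule sorted_wrt_subseq[OF that]) (simp only: sorted_wrt_rev sorted_wrt_upt)
  assume "subseq [b, a, b', a'] (up_down_up n)"
  then obtain xs ys zs where "[b, a, b', a'] = xs @ ys @ zs"
    "subseq xs [1..<n+1]" "subseq ys (rev [1..<n+1])" "subseq zs [1..<n+1]"
    unfolding up_down_up_def subseq_append_iff by blast
  with up[of xs] down[of ys] up[of zs] assms show False
    by (auto simp: Cons_eq_append_conv)
qed

lemma up_down_up_descent:
  assumes "1 < d" "d < n"
  shows "descent (map int (up_down_up n)) (int d)"
proof -
  have "subseq [n] [1..<n+1]" using assms by (simp add: subseq_singleton_left)
  moreover have "subseq [d, 1] (rev [1..<n+1])"
    using assms subseq_upt[of 1 d 1 "n+1"] by (simp add: subseq_rev_iff del: upt_Suc)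
  ultimately have "subseq ([n] @ [d, 1]) ([1..<n+1] @ (rev [1..<n+1] @ [1..<n+1]))"
    by (intro list_emb_append_mono subseq_rev_drop_many)
  then have "subseq [n, d, 1] (up_down_up n)" by (simp add: up_down_up_def)
  from subseq_map[OF this, of int] show ?thesis
    using assms unfolding descent_def by (intro exI[of _ "int 1"] exI[of _ "int n"]) simp
qed

lemma zigzag_if_tight:
  assumes "tight (up_down_up n) w"
  shows "zigzag {1..int n} (map int w)"
  unfolding zigzag_def
proof (intro conjI ballI allI impI notI)
  have tight: "tight w (up_down_up n)" using assms by (rule tight_sym)
  { fix i j assume ij: "i \<in> {1..int n}" "j \<in> {1..int n}" "i < j"
    then obtain i' j' where ij': "i = int i'" "j = int j'" "1 \<le> i'" "i' < j'" "j' \<le> n"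
      by (metis atLeastAtMost_iff nonneg_int_cases of_nat_le_iff of_nat_less_iff of_nat_1 order_trans zero_le_one)
    have "subseq [i', j', i', j'] w \<longleftrightarrow> subseq [i', j', i', j'] (up_down_up n)"
    proof (rule tight_pair[OF tight, of i' j'])
      have "\<not> subseq [j', i', j', i'] (up_down_up n)"
        using ij' by (intro up_down_up_not_subseq) auto
      then show "\<not> subseq [i', j', i', j', i'] (up_down_up n)"
        "\<not> subseq [j', i', j', i', j'] (up_down_up n)"
        unfolding subseq4 subseq5 by (meson less_trans)+
    qed (use ij' in auto)
    then have "subseq [i', j', i', j'] w" using up_down_up_subseq ij' by blast
    from subseq_map[OF this, of int] show "subseq [i, j, i, j] (map int w)" using ij' by simp }
  { fix a b a' b' assume lt: "max a a' < min b b'" and "subseq [b, a, b', a'] (map int w)"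
    then obtain qs where "map int qs = [b, a, b', a']" "subseq qs w"
      unfolding subseq_map_iff by metis
    then obtain a0 b0 a0' b0' where q: "subseq [b0, a0, b0', a0'] w"
      "a = int a0" "b = int b0" "a' = int a0'" "b' = int b0'"
      by (auto simp: map_eq_Cons_conv)
    \<comment> \<open>Cut the alphabet at this threshold. By the choice of \<open>a0\<close> and
      \<open>a0'\<close> the pattern in \<open>w\<close> alternates high, low, high, low;
      \<open>up_down_up n\<close> has no such pattern, so its image is low and \<open>tight\<close>
      excludes the pattern from \<open>w\<close> too.\<close>
    let ?f = "\<lambda>k. min b0 b0' \<le> k"
    have no: "\<not> subseq [p, q, p', q'] (up_down_up n)" if "?f p" "\<not> ?f q" "?f p'" "\<not> ?f q'" for p q p' q'
      using that by (intro up_down_up_not_subseq) auto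
    have "(\<exists>qs. subseq qs w \<and> set qs \<subseteq> UNIV \<and> map ?f qs = [True, False, True, False]) \<longleftrightarrow>
      (\<exists>qs. subseq qs (up_down_up n) \<and> set qs \<subseteq> UNIV \<and> map ?f qs = [True, False, True, False])"
    proof (rule tight_pattern[OF tight], goal_cases)
      case (2 qs)
      show ?case
      proof (intro conjI notI)
        assume "map ?f qs = [True, False, True, False, True]"
        then obtain p q p' q' r where "qs = [p, q, p', q', r]" "?f p" "\<not> ?f q" "?f p'" "\<not> ?f q'"
          by (auto simp: map_eq_Cons_conv)
        with no[of p q p' q'] 2(1) show False
          unfolding subseq4 by (simp only: subseq5) blast
      next
        assume "map ?f qs = [False, True, False, True, False]"
        then obtain p q p' q' r where "qs = [r, p, q, p', q']" "?f p" "\<not> ?f q" "?f p'" "\<not> ?f q'"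
          by (auto simp: map_eq_Cons_conv)
        with no[of p q p' q'] 2(1) show False
          unfolding subseq4 by (simp only: subseq5) blast
      qed
    qed (simp add: distinct_adj_Cons)
    moreover have "\<exists>qs. subseq qs w \<and> set qs \<subseteq> UNIV \<and> map ?f qs = [True, False, True, False]"
      using q lt by (intro exI[of _ "[b0, a0, b0', a0']"]) auto
    ultimately have "\<exists>qs. subseq qs (up_down_up n) \<and> set qs \<subseteq> UNIV \<and> map ?f qs = [True, False, True, False]"
      by (rule iffD1)
    then obtain qs where qs: "subseq qs (up_down_up n)" "map ?f qs = [True, False, True, False]"
      by (elim exE conjE) (rule that)
    then obtain p q p' q' where "qs = [p, q, p', q']" "?f p" "\<not> ?f q" "?f p'" "\<not> ?f q'"
      by (auto simp: map_eq_Cons_conv)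
    with qs(1) no show False by blast }
qed

text \<open>Of three decreasing letters, two adjacent ones would lie in the same sorted
  factor.\<close>

lemma no_descent_if_two_ascents:
  assumes "sorted xs" "sorted ys"
  shows "\<not> descent (xs @ ys) d"
proof
  assume "descent (xs @ ys) d"
  then obtain i j as bs where "i < d" "d < j" "[j, d, i] = as @ bs" "subseq as xs" "subseq bs ys"
    unfolding descent_def subseq_append_iff by blast
  moreover from this have "sorted as" "sorted bs" using assms sorted_wrt_subseq by blast+
  ultimately show False by (auto simp: Cons_eq_append_conv)
qed

subsection \<open>Deductions\<close>

text \<open>One rewriting step: an identity of \<open>E\<close>, read in either direction, under a
  substitution and inside a context. Deductions become chains of such steps, so an invariant need
  only be checked for one step.\<close>

definition elementary :: "(word \<times> word) set \<Rightarrow> word \<Rightarrow> word \<Rightarrow> bool" where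
  "elementary E w w' \<longleftrightarrow> (\<exists>u v a b \<theta>. ((u, v) \<in> E \<or> (v, u) \<in> E) \<and>
     w = a @ subst_word \<theta> u @ b \<and> w' = a @ subst_word \<theta> v @ b)"

lemma elementary_context: "(elementary E)\<^sup>*\<^sup>* w w' \<Longrightarrow> (elementary E)\<^sup>*\<^sup>* (c @ w @ d) (c @ w' @ d)"
proof (induction rule: rtranclp_induct)
  case (step y z)
  from step(2) obtain u v a b \<theta> where "(u, v) \<in> E \<or> (v, u) \<in> E"
    "y = a @ subst_word \<theta> u @ b" "z = a @ subst_word \<theta> v @ b" unfolding elementary_def by blast
  then have "elementary E (c @ y @ d) (c @ z @ d)"
    unfolding elementary_def
    by (intro exI[of _ u] exI[of _ v] exI[of _ "c @ a"] exI[of _ "b @ d"] exI[of _ \<theta>]) simp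
  with step(3) show ?case by (rule rtranclp.rtrancl_into_rtrancl)
qed simp

lemma subst_word_subst_word: "subst_word \<sigma> (subst_word \<theta> u) = subst_word (\<lambda>t. subst_word \<sigma> (\<theta> t)) u"
  by (induction u) auto

lemma elementary_subst: "(elementary E)\<^sup>*\<^sup>* w w' \<Longrightarrow> (elementary E)\<^sup>*\<^sup>* (subst_word \<sigma> w) (subst_word \<sigma> w')"
proof (induction rule: rtranclp_induct)
  case (step y z)
  from step(2) obtain u v a b \<theta> where "(u, v) \<in> E \<or> (v, u) \<in> E"
    "y = a @ subst_word \<theta> u @ b" "z = a @ subst_word \<theta> v @ b" unfolding elementary_def by blast
  then have "elementary E (subst_word \<sigma> y) (subst_word \<sigma> z)"
    unfolding elementary_def
    by (intro exI[of _ u] exI[of _ v] exI[of _ "subst_word \<sigma> a"] exI[of _ "subst_word \<sigma> b"]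
        exI[of _ "\<lambda>t. subst_word \<sigma> (\<theta> t)"]) (simp add: subst_word_subst_word)
  with step(3) show ?case by (rule rtranclp.rtrancl_into_rtrancl)
qed simp

lemma elementary_sym: "(elementary E)\<^sup>*\<^sup>* w w' \<Longrightarrow> (elementary E)\<^sup>*\<^sup>* w' w"
proof -
  have "symp (elementary E)" unfolding elementary_def by (rule sympI) blast
  then show "(elementary E)\<^sup>*\<^sup>* w w' \<Longrightarrow> (elementary E)\<^sup>*\<^sup>* w' w"
    by (metis symp_rtranclp sympD)
qed

lemma deducible_elementary: "deducible E u v \<Longrightarrow> (elementary E)\<^sup>*\<^sup>* u v"
proof (induction rule: deducible.induct)
  case (hyp u v)
  have "subst_word (\<lambda>t. [t]) z = z" for z :: word by (induction z) auto
  with hyp have "elementary E u v"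
    unfolding elementary_def
    by (intro exI[of _ u] exI[of _ v] exI[of _ "[]"] exI[of _ "\<lambda>t. [t]"]) simp
  then show ?case by blast
next
  case (sym u v)
  show ?case using sym.IH by (rule elementary_sym)
next
  case (mult u v u' v')
  from elementary_context[OF mult.IH(1), of "[]" u'] elementary_context[OF mult.IH(2), of v "[]"]
  show ?case by simp
next
  case (subst u v \<theta>)
  then show ?case by (intro elementary_subst)
qed auto

theorem theorem1p2:
  fixes M :: "('a, 'b) monoid_scheme" and x :: "nat \<Rightarrow> var"
  assumes "monoid M"
    and "property_C 4 M"
    and "inj x"
    and "\<forall>n > 0. satisfies M
           (map x [1..<n+1] @ map x (rev [1..<n+1]) @ map x [1..<n+1])
           (map x [1..<n+1] @ concat (map (\<lambda>i. replicate 2 (x i)) [1..<n+1]))"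
  shows "\<not> finitely_based M"
proof
  assume "finitely_based M"
  then obtain E where E: "finite E" "E \<subseteq> identities M"
    and ded: "\<And>u v. satisfies M u v \<Longrightarrow> deducible E u v"
    unfolding finitely_based_def identities_def by blast
  define Y where "Y = (\<Union>(u, v) \<in> E. set u \<union> set v)"
  have "finite Y" using E(1) by (auto simp: Y_def)
  \<comment> \<open>The fresh variables \<open>p\<close> and \<open>q\<close> will stand for the two
    context words of an elementary step, which turns the step into a plain substitution instance of
    an identity in variables from \<open>X\<close>. The value of \<open>n\<close> below is the bound
    in \<open>descents_preserved\<close>.\<close>
  then obtain p where p: "p \<notin> Y" by (metis ex_new_if_finite infinite_UNIV_nat)
  from \<open>finite Y\<close> obtain q where q: "q \<notin> insert p Y"
    by (metis ex_new_if_finite infinite_UNIV_nat finite_insert)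
  define X where "X = insert q (insert p Y)"
  define m where "m = card X"
  define n where "n = 8 * m + 10"
  have X: "finite X" using \<open>finite Y\<close> by (simp add: X_def)
  let ?U = "up_down_up n" and ?V = "[1..<n+1] @ concat (map (\<lambda>i. replicate 2 i) [1..<n+1])"
  \<comment> \<open>The invariant of the deduction: the first conjunct keeps \<open>w\<close>
    zigzag, the second keeps the middle letters in its descending part.\<close>
  let ?P = "\<lambda>w. satisfies M ?U w \<and> (\<forall>d \<in> {int m + 2..int n - int m - 1}. descent (map int w) d)"
  have "satisfies M ?U ?V"
  proof -
    \<comment> \<open>Renaming each \<open>x i\<close> to \<open>i\<close> moves the identity to the
      ordered letters from 1 to \<open>n\<close>.\<close>
    have "subst_word (\<lambda>t. [the_inv x t]) (map x z) = z" for z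
      using assms(3) by (induction z) (auto simp: the_inv_f_f)
    moreover have "subst_word (\<lambda>t. [the_inv x t]) (concat (map (\<lambda>i. replicate 2 (x i)) z)) =
        concat (map (\<lambda>i. replicate 2 i) z)" for z
      using assms(3) by (induction z) (auto simp: numeral_eq_Suc the_inv_f_f)
    moreover have "n > 0" by (simp add: n_def)
    ultimately show ?thesis
      using satisfies_subst_word[OF assms(1) assms(4)[rule_format, of n], of "\<lambda>t. [the_inv x t]"]
      by (simp only: up_down_up_def map_append concat_append)
  qed
  then have "(elementary E)\<^sup>*\<^sup>* ?U ?V" by (intro deducible_elementary ded)
  then have "?P ?V"
  proof (induction rule: rtranclp_induct)
    case base
    have "descent (map int ?U) d" if "d \<in> {int m + 2..int n - int m - 1}" for d
    proof -
      have "1 < nat d" "nat d < n" "int (nat d) = d" using that by auto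
      with up_down_up_descent[of "nat d" n] show ?thesis by simp
    qed
    then show ?case by (simp add: satisfies_refl)
  next
    case (step y z)
    from step(2) obtain u v a b \<theta> where uv: "(u, v) \<in> E \<or> (v, u) \<in> E"
      and y: "y = a @ subst_word \<theta> u @ b" and z: "z = a @ subst_word \<theta> v @ b"
      unfolding elementary_def by blast
    have sat: "satisfies M u v" using uv E(2) satisfies_sym by (auto simp: identities_def)
    have sub: "set u \<subseteq> Y" "set v \<subseteq> Y" using uv unfolding Y_def by fastforce+
    let ?\<theta> = "\<lambda>t. if t = p then map int a else if t = q then map int b else map int (\<theta> t)"
    have ctx: "subst_word ?\<theta> (p # t @ [q]) = map int (a @ subst_word \<theta> t @ b)" if "set t \<subseteq> Y" for t
    proof -
      have "subst_word ?\<theta> t = map int (subst_word \<theta> t)"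
        using that p q by (induction t) auto
      then show ?thesis using q by simp
    qed
    have "satisfies M y z"
      unfolding y z
      by (intro satisfies_append assms(1) satisfies_refl satisfies_subst_word sat)
    with step.IH have sz: "satisfies M ?U z" by (blast intro: satisfies_trans)
    have "satisfies M ([p] @ u @ [q]) ([p] @ v @ [q])"
      by (intro satisfies_append assms(1) satisfies_refl sat)
    then have tight: "tight (p # u @ [q]) (p # v @ [q])"
      using property_C_tight[OF assms(1,2)] by simp
    have zig: "zigzag {1..int n} (map int w)" if "satisfies M ?U w" for w
      using that by (intro zigzag_if_tight property_C_tight[OF assms(1,2)])
    have "descent (map int z) d" if "d \<in> {int m + 2..int n - int m - 1}" for d
      using descents_preserved[OF tight, of "int n" ?\<theta> X d] zig[OF sz] zig[of y] step.IH X that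
        sub ctx[OF sub(1)] ctx[OF sub(2)]
      unfolding y z by (simp add: X_def[symmetric] m_def[symmetric] n_def) (auto simp: X_def)
    with sz show ?case by blast
  qed
  \<comment> \<open>The middle range is nonempty, as its upper end is \<open>7 * m + 9\<close>,
    whereas \<open>?V\<close> is a product of two sorted words and has no descent.\<close>
  then have "descent (map int ?V) (int m + 2)" by (auto simp: n_def)
  moreover have "sorted (concat (map (\<lambda>i. replicate 2 i) k))" if "sorted k" for k :: word
    using that by (induction k) (auto simp: numeral_eq_Suc)
  moreover have "sorted (map int k)" if "sorted k" for k
    using that by (simp add: sorted_map)
  ultimately show False
    using no_descent_if_two_ascents[of "map int [1..<n+1]"
        "map int (concat (map (\<lambda>i. replicate 2 i) [1..<n+1]))"]
    by (simp only: map_append sorted_upt)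
qed

end
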